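(* Let $A=\begin{bmatrix} a & b\\ c & d\end{bmatrix}$ be a real $2\times 2$ constant matrix, and consider the system $\boldsymbol{x}'(t)=A\boldsymbol{x}(t)$, $t\in\mathbb{R}$. (1) If $A$ has distinct, positive eigenvalues $\lambda_1>\lambda_2>0$, then the system is Hyers-Ulam stable on $\mathbb{R}$, with HUS constant $$K=\begin{cases}\|A^{-1}\|_\infty & \text{if } \lambda_1\ge a\ge\lambda_2>0,\\[4pt] \max\left\{\frac{\lambda_1+\lambda_2+|b|-a}{\lambda_1\lambda_2},\ \frac{a+|c|+2(\lambda_2-a)\left(\frac{\lambda_1-a}{\lambda_2-a}\right)^{\frac{-\lambda_2}{\lambda_1-\lambda_2}}}{\lambda_1\lambda_2}\right\} & \text{if } \lambda_1>\lambda_2>a,\\[8pt] \max\left\{\frac{\lambda_1+\lambda_2+|b|-a+2(a-\lambda_1)\left(\frac{a-\lambda_2}{a-\lambda_1}\right)^{\frac{-\lambda_2}{\lambda_1-\lambda_2}}}{\lambda_1\lambda_2},\ \frac{a+|c|}{\lambda_1\lambda_2}\right\} & \text{if } a>\lambda_1>\lambda_2.\end{cases}$$ (2) If $A$ has distinct, negative eigenvalues $0>\lambda_1>\lambda_2$, then the system is Hyers-Ulam stable on $\mathbb{R}$, with HUS constant $$K=\begin{cases}\|A^{-1}\|_\infty & \text{if } 0>\lambda_1\ge a\ge\lambda_2,\\[4pt] \max\left\{\frac{|\lambda_1|+|\lambda_2|+a+|b|+2(\lambda_1-a)\left(\frac{\lambda_1-a}{\lambda_2-a}\right)^{\frac{\lambda_2}{\lambda_1-\lambda_2}}}{\lambda_1\lambda_2},\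 \frac{|a|+|c|}{\lambda_1\lambda_2}\right\} & \text{if } \lambda_1>\lambda_2>a,\\[8pt] \max\left\{\frac{|\lambda_1|+|\lambda_2|+a+|b|}{\lambda_1\lambda_2},\ \frac{-a+|c|+2(a-\lambda_2)\left(\frac{a-\lambda_1}{a-\lambda_2}\right)^{\frac{-\lambda_2}{\lambda_1-\lambda_2}}}{\lambda_1\lambda_2}\right\} & \text{if } a>\lambda_1>\lambda_2.\end{cases}$$ (3) If $A$ has a repeated eigenvalue $\lambda\ne0$ (real), then $A$ has the form $$A=\begin{bmatrix} a & b\\ c& d\end{bmatrix}=\begin{bmatrix}\lambda-\eta & b\\ c&\lambda+\eta\end{bmatrix}$$ with $\eta=\lambda-a$, where $bc+\eta^2=0$, and the system is Hyers-Ulam stable on $\mathbb{R}$, with HUS constant $$K=\begin{cases}\|A^{-1}\|_\infty & \text{if } \eta=0\ (bc=0),\\[4pt] \max\left\{\frac{\lambda+\eta+|b|}{\lambda^2},\ \frac{\lambda+|c|+\eta\left(-1+2e^{-\frac{\lambda}{\eta}}\right)}{\lambda^2}\right\} & \text{if } \eta>0,\\[8pt] \max\left\{\frac{\lambda+|\eta|+|c|}{\lambda^2},\ \frac{\lambda+|b|+|\eta|\left(-1+2e^{-\frac{\lambda}{|\eta|}}\right)}{\lambda^2}\right\} & \text{if } \eta<0\end{cases}$$ when $\lambda>0$, and $$K=\begin{cases}\|A^{-1}\|_\infty & \text{if } \eta=0\ (bc=0),\\[4pt] \max\left\{\frac{|\lambda|+\eta+|c|}{\lambda^2},\ \frac{|\lambda|+|b|+\eta\left(-1+2e^{\frac{\lambda}{\eta}}\right)}{\lambda^2}\right\}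 & \text{if } \eta>0,\\[8pt] \max\left\{\frac{|\lambda|+|\eta|+|b|}{\lambda^2},\ \frac{|\lambda|+|c|+|\eta|\left(-1+2e^{-\frac{\lambda}{\eta}}\right)}{\lambda^2}\right\} & \text{if } \eta<0\end{cases}$$ when $\lambda<0$.
   Context: For $\boldsymbol{v}=(v_1,v_2)^T\in\mathbb{R}^2$, $\|\boldsymbol{v}\|_\infty=\max\{|v_1|,|v_2|\}$, and for a real $2\times2$ matrix $M=(m_{ij})$, $\|M\|_\infty=\max_{i=1,2}\{|m_{i1}|+|m_{i2}|\}$ (the induced matrix norm). The system $\boldsymbol{x}'=A\boldsymbol{x}$ is Hyers-Ulam stable on $\mathbb{R}$ with Hyers-Ulam stability (HUS) constant $K>0$ if for every $\varepsilon>0$ and every differentiable $\boldsymbol{\phi}:\mathbb{R}\to\mathbb{R}^2$ with $\|\boldsymbol{\phi}'(t)-A\boldsymbol{\phi}(t)\|_\infty\le\varepsilon$ for all $t\in\mathbb{R}$, there exists a solution $\boldsymbol{x}:\mathbb{R}\to\mathbb{R}^2$ of $\boldsymbol{x}'=A\boldsymbol{x}$ with $\|\boldsymbol{\phi}(t)-\boldsymbol{x}(t)\|_\infty\le K\varepsilon$ for all $t\in\mathbb{R}$. (The constant $K$ does not depend on $\varepsilon$ or $\boldsymbol{\phi}$.) *)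

theory Defs
  imports "HOL-Analysis.Analysis" "HOL-Computational_Algebra.Polynomial"
begin

definition is_eigenvalue :: "real^'n^'n \<Rightarrow> real \<Rightarrow> bool" where
  "is_eigenvalue A l \<longleftrightarrow> (\<exists>v. v \<noteq> 0 \<and> A *v v = l *\<^sub>R v)"

text \<open>The determinant of \<open>X I - A\<close>, taken over the polynomial ring.\<close>

definition charpoly :: "real^'n^'n \<Rightarrow> real poly" where
  "charpoly A = det (\<chi> i j. (if i = j then [:0, 1:] else 0) - [:A $ i $ j:])"

text \<open>\<open>Repeated\<close> refers to algebraic multiplicity, so that Jordan blocks are included.\<close>

definition is_repeated_eigenvalue :: "real^'n^'n \<Rightarrow> real \<Rightarrow> bool" where
  "is_repeated_eigenvalue A l \<longleftrightarrow> is_eigenvalue A l \<and> 2 \<le> order l (charpoly A)"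

text \<open>The matrix norm induced by the vector norm \<^const>\<open>infnorm\<close>: the maximal absolute row sum.\<close>

definition mat_infnorm :: "real^'n^'m \<Rightarrow> real" where
  "mat_infnorm M = Max (range (\<lambda>i. \<Sum>j\<in>UNIV. \<bar>M $ i $ j\<bar>))"

definition is_solution :: "real^'n^'n \<Rightarrow> (real \<Rightarrow> real^'n) \<Rightarrow> bool" where
  "is_solution A x \<longleftrightarrow> (\<forall>t. (x has_vector_derivative A *v x t) (at t))"

definition hyers_ulam_stable_with :: "real^'n^'n \<Rightarrow> real \<Rightarrow> bool" where
  "hyers_ulam_stable_with A K \<longleftrightarrow> K > 0 \<and>
    (\<forall>\<epsilon>>0. \<forall>\<phi>. (\<forall>t. \<phi> differentiable (at t)) \<and>
        (\<forall>t. infnorm (vector_derivative \<phi> (at t) - A *v \<phi> t) \<le> \<epsilon>) \<longrightarrow>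
      (\<exists>x. is_solution A x \<and> (\<forall>t. infnorm (\<phi> t - x t) \<le> K * \<epsilon>)))"

lemma mat_infnorm_2:
  fixes M :: "real^2^2"
  shows "mat_infnorm M =
    max (\<bar>M $ 1 $ 1\<bar> + \<bar>M $ 1 $ 2\<bar>) (\<bar>M $ 2 $ 1\<bar> + \<bar>M $ 2 $ 2\<bar>)"
  by (simp add: mat_infnorm_def UNIV_2 sum_2)

lemma charpoly_2:
  fixes A :: "real^2^2"
  shows "charpoly A = [:det A, - (A $ 1 $ 1 + A $ 2 $ 2), 1:]"
  by (simp add: charpoly_def det_2 algebra_simps)

end

theory Submission
  imports Defs
begin

text \<open>Suppose first that both eigenvalues \<open>l1 \<ge> l2\<close> are positive. Multiplying an approximate solution
  \<open>\<phi>\<close> with defect \<open>q = \<phi>' - A \<phi>\<close> by \<open>exp (- s A)\<close> gives a curve whose derivative is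
  \<open>exp (- s A) q\<close>. The exponential decays as \<open>s\<close> grows, so the curve stays within
  a bounded distance of its initial value, and a limit of it at infinity is the initial value of the desired exact
  solution. The distance is controlled by \<open>\<epsilon>\<close> times the integral over \<open>[0, \<infinity>)\<close> of the absolute row
  sums of \<open>exp (- s A)\<close>, maximised over the rows (\<open>hyers_ulam_of_propagator\<close>).

  The stability constants of the theorem are these integrals. By Cayley-Hamilton,
  \<open>exp (- s A) = exp (- l2 s) I - w s (A - l2 I)\<close> with \<open>w\<close> nonnegative and of integral \<open>1 / (l1 l2)\<close>.
  The off-diagonal entries never change sign and contribute \<open>\<bar>b\<bar>\<close> and \<open>\<bar>c\<bar>\<close> over \<open>l1 l2\<close>.
  A diagonal entry belonging to the entry \<open>a\<close> of \<open>A\<close> keeps its sign if \<open>a \<le> l1\<close>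
  (\<open>integral_diag_entry_nonneg\<close>). If \<open>l2 \<le> a \<le> l1\<close>, this holds for both diagonal entries, and the
  integrals add up to the absolute row sums of the inverse of \<open>A\<close>, because the integral of
  \<open>exp (- s A)\<close> itself is that inverse. If \<open>a > l1\<close>, the entry changes sign exactly once, at a time \<open>p\<close> where
  \<open>(a - l2) w p = exp (- l2 p)\<close>, which adds the term \<open>2 (a - l1) exp (- l2 p) / (l1 l2)\<close>
  (\<open>integral_diag_entry_sign_change\<close>). Solving for \<open>p\<close> turns \<open>exp (- l2 p)\<close> into a real power if the eigenvalues
  differ and into \<open>exp (- l / (a - l))\<close> if they coincide. If instead \<open>a < l2\<close>, the other diagonal
  entry exceeds \<open>l1\<close> and the roles of the rows are exchanged.

  For negative eigenvalues, reversing time replaces \<open>A\<close> by \<open>- A\<close>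
  (\<open>hyers_ulam_time_reversal\<close>).\<close>

section \<open>Stability from an explicit propagator\<close>

lemma bounded_bilinear_matrix_vector_mult:
  "bounded_bilinear ((*v) :: real^'n^'m \<Rightarrow> real^'n \<Rightarrow> real^'m)"
  unfolding bilinear_conv_bounded_bilinear[symmetric] bilinear_def
  by (auto intro!: linearI simp: matrix_vector_mult_def vec_eq_iff algebra_simps sum.distrib sum_distrib_left)

lemmas matrix_vector_derivative =
  bounded_bilinear.has_vector_derivative[OF bounded_bilinear_matrix_vector_mult]

lemma infnorm_le_cart:
  fixes x :: "real^'n"
  assumes "\<And>i. \<bar>x $ i\<bar> \<le> c"
  shows "infnorm x \<le> c"
  unfolding infnorm_cart by (rule cSup_least) (use assms in auto)

lemma matrix_vector_mult_uminus_left: "- M *v u = - (M *v u)" for M :: "real^'n^'m"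
  by (simp add: matrix_vector_mult_def vec_eq_iff sum_negf)

lemma has_vector_derivative_affine:
  fixes f :: "real \<Rightarrow> 'a::real_normed_vector"
  assumes "(f has_vector_derivative D) (at (c + k * s))"
  shows "((\<lambda>s. f (c + k * s)) has_vector_derivative k *\<^sub>R D) (at s)"
proof -
  have "((\<lambda>s. c + k * s) has_vector_derivative k) (at s)"
    by (auto intro!: derivative_eq_intros)
  from vector_diff_chain_at[OF this assms] show ?thesis
    by (simp add: o_def)
qed

text \<open>The product is constant in \<open>s\<close>: its derivative is
  \<open>E (c - s) (A - A) E s v = 0\<close> because \<open>A\<close> commutes with the propagator. Comparing with \<open>s = 0\<close>
  gives the flow property of \<open>E s = exp (- s A)\<close> from its differential equation alone.\<close>

lemma propagator_cocycle:
  fixes A :: "real^'n^'n" and E :: "real \<Rightarrow> real^'n^'n"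
  assumes E0: "E 0 = mat 1"
    and dE: "\<And>s. (E has_vector_derivative - (A ** E s)) (at s)"
    and comm: "\<And>s. A ** E s = E s ** A"
  shows "E (c - s) *v (E s *v v) = E c *v v"
proof -
  have dE': "((\<lambda>s. E (c - s)) has_vector_derivative A ** E (c - s)) (at s)" for s
    using has_vector_derivative_affine[of E "- (A ** E (c - s))" c "-1" s] dE[of "c - s"] by simp
  have dv: "((\<lambda>s. E s *v v) has_vector_derivative - (A ** E s) *v v) (at s)" for s
    using matrix_vector_derivative[OF dE[of s] has_vector_derivative_const[of v]]
    by simp
  have "((\<lambda>s. E (c - s) *v (E s *v v)) has_vector_derivative 0) (at s within UNIV)" for s
  proof -
    have "E (c - s) *v (- (A ** E s) *v v) + (A ** E (c - s)) *v (E s *v v) = 0"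
      unfolding comm[of "c - s"]
      by (simp add: matrix_vector_mult_uminus_left linear_neg[OF matrix_vector_mul_linear]
          flip: matrix_vector_mul_assoc)
    then show ?thesis
      using matrix_vector_derivative[OF dE'[of s] dv[of s]] by simp
  qed
  then obtain k where "\<And>s. E (c - s) *v (E s *v v) = k"
    using has_vector_derivative_zero_constant[of UNIV "\<lambda>s. E (c - s) *v (E s *v v)"] by auto
  from this[of s] this[of 0] show ?thesis
    by (simp add: E0)
qed

text \<open>The curve \<open>r \<mapsto> E r \<phi> (t + r)\<close> has derivative \<open>E r q (t + r)\<close>, where \<open>q = \<phi>' - A \<phi>\<close>
  is the defect of \<open>\<phi>\<close>. As every component of \<open>q\<close> is at most \<open>\<epsilon>\<close>, the
  \<open>i\<close>-th component of the curve moves, on \<open>[0, s]\<close>, by at most \<open>\<epsilon>\<close> times the integral of the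
  \<open>i\<close>-th absolute row sum of \<open>E\<close>, that is by at most \<open>K \<epsilon>\<close>. The values \<open>E n \<phi> n\<close> therefore stay
  bounded, a subsequence converges to some \<open>x0\<close>, and \<open>x t = E (- t) x0\<close> is a solution. Since
  \<open>E (- t) E n \<phi> n = E (n - t) \<phi> (t + (n - t))\<close> lies within \<open>K \<epsilon>\<close> of \<open>\<phi> t\<close> as soon as \<open>n \<ge> t\<close>, so does \<open>x t\<close>.

  The derivative of \<open>\<phi>\<close> need not be continuous; the integral is the Henstock-Kurzweil integral, for
  which the fundamental theorem of calculus holds for every derivative.\<close>

theorem hyers_ulam_of_propagator:
  fixes A :: "real^'n^'n" and E :: "real \<Rightarrow> real^'n^'n"
  assumes E0: "E 0 = mat 1"
    and dE: "\<And>s. (E has_vector_derivative - (A ** E s)) (at s)"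
    and comm: "\<And>s. A ** E s = E s ** A"
    and K: "K > 0"
    and bound: "\<And>i s. s \<ge> 0 \<Longrightarrow> (\<Sum>j\<in>UNIV. integral {0..s} (\<lambda>r. \<bar>E r $ i $ j\<bar>)) \<le> K"
  shows "hyers_ulam_stable_with A K"
  unfolding hyers_ulam_stable_with_def
proof (intro conjI allI impI K)
  fix \<epsilon> :: real and \<phi> :: "real \<Rightarrow> real^'n"
  assume \<epsilon>: "\<epsilon> > 0"
    and "(\<forall>t. \<phi> differentiable (at t)) \<and>
      (\<forall>t. infnorm (vector_derivative \<phi> (at t) - A *v \<phi> t) \<le> \<epsilon>)"
  then have diff: "\<And>t. \<phi> differentiable (at t)"
    and small: "\<And>t. infnorm (vector_derivative \<phi> (at t) - A *v \<phi> t) \<le> \<epsilon>"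
    by auto
  define q where "q t = vector_derivative \<phi> (at t) - A *v \<phi> t" for t
  have q: "\<bar>q t $ j\<bar> \<le> \<epsilon>" for t j
    using component_le_infnorm_cart[of "q t" j] small[of t] by (simp add: q_def)
  have d\<phi>: "(\<phi> has_vector_derivative A *v \<phi> t + q t) (at t)" for t
    using diff[of t] by (simp add: q_def flip: vector_derivative_works)
  have contE: "continuous_on S (\<lambda>r. E r $ i $ j)" for S i j
    by (intro continuous_at_imp_continuous_on ballI isCont_vec_nth has_vector_derivative_continuous[OF dE])
  have step: "infnorm (E s *v \<phi> (t + s) - \<phi> t) \<le> K * \<epsilon>" if s: "s \<ge> 0" for t s
  proof (rule infnorm_le_cart)
    fix i
    define h where "h r = (\<Sum>j\<in>UNIV. \<bar>E r $ i $ j\<bar>)" for r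
    have dg: "((\<lambda>r. (E r *v \<phi> (t + r)) $ i) has_vector_derivative (E r *v q (t + r)) $ i) (at r)" for r
    proof -
      have "((\<lambda>r. \<phi> (t + r)) has_vector_derivative A *v \<phi> (t + r) + q (t + r)) (at r)"
        using has_vector_derivative_affine[of \<phi> "A *v \<phi> (t + r) + q (t + r)" t 1 r] d\<phi>[of "t + r"]
        by simp
      moreover have "E r *v (A *v \<phi> (t + r) + q (t + r)) + (- (A ** E r)) *v \<phi> (t + r) = E r *v q (t + r)"
        by (simp add: comm matrix_vector_mult_uminus_left matrix_vector_right_distrib matrix_vector_mul_assoc)
      ultimately have "((\<lambda>r. E r *v \<phi> (t + r)) has_vector_derivative E r *v q (t + r)) (at r)"
        using matrix_vector_derivative[OF dE[of r], of "\<lambda>r. \<phi> (t + r)" "A *v \<phi> (t + r) + q (t + r)"]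
        by simp
      then show ?thesis
        by (rule bounded_linear.has_vector_derivative[OF bounded_linear_vec_nth])
    qed
    have int: "((\<lambda>r. (E r *v q (t + r)) $ i) has_integral
        (E s *v \<phi> (t + s)) $ i - (E 0 *v \<phi> (t + 0)) $ i) {0..s}"
      by (rule fundamental_theorem_of_calculus[OF s]) (rule has_vector_derivative_at_within[OF dg])
    have hint: "h integrable_on {0..s}"
      unfolding h_def by (intro integrable_continuous_real continuous_intros contE)
    have "\<bar>(E r *v q (t + r)) $ i\<bar> \<le> \<epsilon> * h r" for r
    proof -
      have "\<bar>(E r *v q (t + r)) $ i\<bar> \<le> (\<Sum>j\<in>UNIV. \<bar>E r $ i $ j * q (t + r) $ j\<bar>)"
        unfolding matrix_vector_mult_def by simp
      also have "\<dots> \<le> (\<Sum>j\<in>UNIV. \<epsilon> * \<bar>E r $ i $ j\<bar>)"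
        using q by (auto intro!: sum_mono mult_left_mono simp: abs_mult mult.commute[of \<epsilon>])
      finally show ?thesis by (simp add: h_def sum_distrib_left)
    qed
    then have "\<bar>(E s *v \<phi> (t + s)) $ i - (E 0 *v \<phi> (t + 0)) $ i\<bar> \<le> integral {0..s} (\<lambda>r. \<epsilon> * h r)"
      using integral_norm_bound_integral[of "\<lambda>r. (E r *v q (t + r)) $ i" "{0..s}" "\<lambda>r. \<epsilon> * h r"]
        int integrable_on_mult_right[OF hint, of \<epsilon>] by (auto simp: integral_unique has_integral_integrable)
    also have "\<dots> = \<epsilon> * (\<Sum>j\<in>UNIV. integral {0..s} (\<lambda>r. \<bar>E r $ i $ j\<bar>))"
      unfolding h_def
      by (simp, subst integral_sum) (auto intro!: integrable_continuous_real continuous_intros contE)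
    also have "\<dots> \<le> K * \<epsilon>"
      using bound[OF s] \<epsilon> by simp
    finally show "\<bar>(E s *v \<phi> (t + s) - \<phi> t) $ i\<bar> \<le> K * \<epsilon>"
      by (simp add: E0)
  qed
  have "bounded (range (\<lambda>n. E (real n) *v \<phi> (real n) - \<phi> 0))"
  proof (rule boundedI)
    fix y assume "y \<in> range (\<lambda>n. E (real n) *v \<phi> (real n) - \<phi> 0)"
    then have "infnorm y \<le> K * \<epsilon>"
      using step[of _ 0] by auto
    then show "norm y \<le> sqrt DIM(real^'n) * (K * \<epsilon>)"
      by (meson norm_le_infnorm mult_left_mono order_trans real_sqrt_ge_zero of_nat_0_le_iff)
  qed
  \<comment> \<open>A subsequence is enough: the estimate is passed to the limit for each time separately.\<close>
  then obtain y0 \<sigma> where \<sigma>: "strict_mono \<sigma>"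
    and "((\<lambda>n. E (real n) *v \<phi> (real n) - \<phi> 0) \<circ> \<sigma>) \<longlonglongrightarrow> y0"
    using bounded_imp_convergent_subsequence by blast
  then have "(\<lambda>n. (E (real (\<sigma> n)) *v \<phi> (real (\<sigma> n)) - \<phi> 0) + \<phi> 0) \<longlonglongrightarrow> y0 + \<phi> 0"
    by (intro tendsto_intros) (simp add: o_def)
  then obtain x0 where x0: "(\<lambda>n. E (real (\<sigma> n)) *v \<phi> (real (\<sigma> n))) \<longlonglongrightarrow> x0"
    by auto
  define x where "x t = E (- t) *v x0" for t
  have "is_solution A x"
    unfolding is_solution_def x_def
  proof
    fix t
    have "((\<lambda>t. E (- t)) has_vector_derivative A ** E (- t)) (at t)"
      using has_vector_derivative_affine[of E "- (A ** E (- t))" 0 "-1" t] dE[of "- t"] by simp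
    from matrix_vector_derivative[OF this has_vector_derivative_const[of x0]]
    show "((\<lambda>t. E (- t) *v x0) has_vector_derivative A *v (E (- t) *v x0)) (at t)"
      by (simp add: matrix_vector_mul_assoc)
  qed
  moreover have "infnorm (\<phi> t - x t) \<le> K * \<epsilon>" for t
  proof -
    have "(\<lambda>n. infnorm (\<phi> t - E (- t) *v (E (real (\<sigma> n)) *v \<phi> (real (\<sigma> n))))) \<longlonglongrightarrow> infnorm (\<phi> t - x t)"
      unfolding x_def by (intro tendsto_intros bounded_linear.tendsto[OF matrix_vector_mul_bounded_linear] x0)
    moreover have "infnorm (\<phi> t - E (- t) *v (E (real (\<sigma> n)) *v \<phi> (real (\<sigma> n)))) \<le> K * \<epsilon>"
      if "n \<ge> nat \<lceil>t\<rceil>" for n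
    proof -
      have "real (\<sigma> n) \<ge> t"
        using seq_suble[OF \<sigma>, of n] that by linarith
      then show ?thesis
        using step[of "real (\<sigma> n) - t" t]
          propagator_cocycle[OF E0 dE comm, of "real (\<sigma> n) - t" "real (\<sigma> n)" "\<phi> (real (\<sigma> n))"]
        by (simp add: infnorm_sub)
    qed
    ultimately show ?thesis
      by (meson LIMSEQ_le_const2)
  qed
  ultimately show "\<exists>x. is_solution A x \<and> (\<forall>t. infnorm (\<phi> t - x t) \<le> K * \<epsilon>)"
    by blast
qed

text \<open>If \<open>\<phi>\<close> solves \<open>x' = A x\<close> up to a defect, then \<open>\<phi> (- t)\<close> solves \<open>x' = - A x\<close> up to the reflected,
  negated defect. This reduces negative eigenvalues to positive ones.\<close>

lemma hyers_ulam_time_reversal: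
  fixes A :: "real^'n^'n"
  assumes "hyers_ulam_stable_with (- A) K"
  shows "hyers_ulam_stable_with A K"
  unfolding hyers_ulam_stable_with_def
proof (intro conjI allI impI)
  show "K > 0" using assms by (simp add: hyers_ulam_stable_with_def)
  have rev: "((\<lambda>t. f (- t)) has_vector_derivative - D) (at t)"
    if "(f has_vector_derivative D) (at (- t))" for f :: "real \<Rightarrow> real^'n" and D t
    using has_vector_derivative_affine[of f D 0 "-1" t] that by simp
  fix \<epsilon> :: real and \<phi> :: "real \<Rightarrow> real^'n"
  assume \<epsilon>: "\<epsilon> > 0"
    and *: "(\<forall>t. \<phi> differentiable (at t)) \<and>
      (\<forall>t. infnorm (vector_derivative \<phi> (at t) - A *v \<phi> t) \<le> \<epsilon>)"
  then have d: "((\<lambda>t. \<phi> (- t)) has_vector_derivative - vector_derivative \<phi> (at (- t))) (at t)" for t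
    by (intro rev) (simp flip: vector_derivative_works)
  have "infnorm (vector_derivative (\<lambda>t. \<phi> (- t)) (at t) - - A *v \<phi> (- t)) \<le> \<epsilon>" for t
  proof -
    have "vector_derivative (\<lambda>t. \<phi> (- t)) (at t) - - A *v \<phi> (- t)
        = - (vector_derivative \<phi> (at (- t)) - A *v \<phi> (- t))"
      using vector_derivative_at[OF d[of t]] by (simp add: matrix_vector_mult_uminus_left)
    then show ?thesis using * by (metis infnorm_neg)
  qed
  moreover have "(\<lambda>t. \<phi> (- t)) differentiable (at t)" for t
    using d[of t] by (rule differentiableI_vector)
  ultimately obtain x where x: "is_solution (- A) x" "\<And>t. infnorm (\<phi> (- t) - x t) \<le> K * \<epsilon>"
    using assms \<epsilon> unfolding hyers_ulam_stable_with_def by (metis (mono_tags, lifting))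
  have "is_solution A (\<lambda>t. x (- t))"
    using rev x(1) unfolding is_solution_def matrix_vector_mult_uminus_left by fastforce
  moreover have "infnorm (\<phi> t - x (- t)) \<le> K * \<epsilon>" for t
    using x(2)[of "- t"] by simp
  ultimately show "\<exists>x. is_solution A x \<and> (\<forall>t. infnorm (\<phi> t - x t) \<le> K * \<epsilon>)"
    by blast
qed

section \<open>The Putzer weight\<close>

text \<open>The solution of \<open>w' = exp (- l2 s) - l1 w\<close>, \<open>w 0 = 0\<close>, that appears in Putzer's formula for
  the exponential of a \<open>2 \<times> 2\<close> matrix:
  \<open>exp (- s A) = exp (- l2 s) I - w s (A - l2 I)\<close>. The second branch tends to the first as
  \<open>l2\<close> tends to \<open>l1\<close>, so one argument covers distinct and repeated eigenvalues.\<close>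

definition putzer_weight :: "real \<Rightarrow> real \<Rightarrow> real \<Rightarrow> real" where
  "putzer_weight l1 l2 s =
     (if l1 = l2 then s * exp (- l1 * s) else (exp (- l2 * s) - exp (- l1 * s)) / (l1 - l2))"

lemma putzer_weight_0 [simp]: "putzer_weight l1 l2 0 = 0"
  by (simp add: putzer_weight_def)

lemma DERIV_putzer_weight [derivative_intros]:
  "(putzer_weight l1 l2 has_real_derivative exp (- l2 * s) - l1 * putzer_weight l1 l2 s) (at s within S)"
proof (cases "l1 = l2")
  case True
  then have "putzer_weight l1 l2 = (\<lambda>s. s * exp (- l1 * s))"
    by (simp add: putzer_weight_def fun_eq_iff)
  with True show ?thesis
    by (auto intro!: derivative_eq_intros)
next
  case False
  then have "putzer_weight l1 l2 = (\<lambda>s. (exp (- l2 * s) - exp (- l1 * s)) / (l1 - l2))"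
    by (simp add: putzer_weight_def fun_eq_iff)
  moreover have "((\<lambda>s. (exp (- l2 * s) - exp (- l1 * s)) / (l1 - l2)) has_real_derivative
      (l1 * exp (- l1 * s) - l2 * exp (- l2 * s)) / (l1 - l2)) (at s within S)"
    using False by (auto intro!: derivative_eq_intros)
  moreover have "(l1 * exp (- l1 * s) - l2 * exp (- l2 * s)) / (l1 - l2)
      = exp (- l2 * s) - l1 * ((exp (- l2 * s) - exp (- l1 * s)) / (l1 - l2))"
    using False by (simp add: divide_simps) (simp add: algebra_simps)
  ultimately show ?thesis by simp
qed

lemma putzer_weight_diff: "(l1 - l2) * putzer_weight l1 l2 s = exp (- l2 * s) - exp (- l1 * s)"
  by (simp add: putzer_weight_def)

text \<open>The derivative of \<open>w s exp (l2 s)\<close> is \<open>exp (- (l1 - l2) s)\<close>, which is positive. Monotonicity of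
  this ratio is what makes a diagonal entry of the propagator change sign at most once.\<close>

lemma putzer_weight_ratio_mono:
  assumes "s \<le> t"
  shows "putzer_weight l1 l2 s * exp (l2 * s) \<le> putzer_weight l1 l2 t * exp (l2 * t)"
proof (rule DERIV_nonneg_imp_nondecreasing[OF assms])
  fix x
  have "((\<lambda>x. putzer_weight l1 l2 x * exp (l2 * x)) has_real_derivative
      exp (l2 * x) * (exp (- l2 * x) - (l1 - l2) * putzer_weight l1 l2 x)) (at x)"
    by (auto intro!: derivative_eq_intros simp: algebra_simps)
  moreover have "exp (l2 * x) * (exp (- l2 * x) - (l1 - l2) * putzer_weight l1 l2 x) \<ge> 0"
    unfolding putzer_weight_diff by simp
  ultimately show "\<exists>y. ((\<lambda>x. putzer_weight l1 l2 x * exp (l2 * x)) has_real_derivative y) (at x) \<and> 0 \<le> y"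
    by blast
qed

lemma putzer_weight_nonneg: "s \<ge> 0 \<Longrightarrow> putzer_weight l1 l2 s \<ge> 0"
  using putzer_weight_ratio_mono[of 0 s l1 l2] by (simp add: zero_le_mult_iff)

section \<open>Integrals of absolute values of the propagator entries\<close>

text \<open>Up to \<open>p\<close> the integral is \<open>G p - G 0\<close>, and from \<open>p\<close> on it is \<open>G p - G t\<close>. Nonnegativity of the
  primitive \<open>G\<close> beyond \<open>p\<close> allows \<open>G t\<close> to be dropped. In the application \<open>G\<close> tends to \<open>0\<close>
  at infinity, so the bound is the value of the improper integral.\<close>

lemma integral_abs_one_sign_change:
  fixes f G :: "real \<Rightarrow> real"
  assumes G: "\<And>s. (G has_real_derivative f s) (at s)"
    and cont: "continuous_on UNIV f"
    and p: "p \<ge> 0"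
    and pos: "\<And>s. 0 \<le> s \<Longrightarrow> s \<le> p \<Longrightarrow> f s \<ge> 0"
    and neg: "\<And>s. p \<le> s \<Longrightarrow> f s \<le> 0"
    and G_pos: "\<And>s. p \<le> s \<Longrightarrow> G s \<ge> 0"
    and t: "t \<ge> 0"
  shows "integral {0..t} (\<lambda>s. \<bar>f s\<bar>) \<le> 2 * G p - G 0"
proof -
  have int: "integral {u..v} (\<lambda>s. \<bar>f s\<bar>) = G v - G u" if "0 \<le> u" "u \<le> v" "v \<le> p" for u v
  proof -
    have "((\<lambda>s. \<bar>f s\<bar>) has_integral G v - G u) {u..v}"
      using that pos
      by (intro has_integral_eq[OF _ fundamental_theorem_of_calculus[of u v G f]])
         (auto intro: has_vector_derivative_at_within[OF G[unfolded has_real_derivative_iff_has_vector_derivative]])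
    then show ?thesis by (rule integral_unique)
  qed
  have int': "integral {p..v} (\<lambda>s. \<bar>f s\<bar>) = G p - G v" if "p \<le> v" for v
  proof -
    have "((\<lambda>s. - \<bar>f s\<bar>) has_integral G v - G p) {p..v}"
      using that neg
      by (intro has_integral_eq[OF _ fundamental_theorem_of_calculus[of p v G f]])
         (auto intro: has_vector_derivative_at_within[OF G[unfolded has_real_derivative_iff_has_vector_derivative]])
    from has_integral_neg[OF this] show ?thesis by (simp add: integral_unique)
  qed
  have nonneg: "integral {u..v} (\<lambda>s. \<bar>f s\<bar>) \<ge> 0" for u v
    by (rule Henstock_Kurzweil_Integration.integral_nonneg)
       (auto intro!: integrable_continuous_real continuous_intros continuous_on_subset[OF cont])
  show ?thesis
  proof (cases "t \<le> p")
    case True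
    then show ?thesis
      using int[of 0 t] int[of t p] nonneg[of t p] G_pos[of p] t by simp
  next
    case False
    have "(\<lambda>s. \<bar>f s\<bar>) integrable_on {0..t}"
      by (auto intro!: integrable_continuous_real continuous_intros continuous_on_subset[OF cont])
    then have "integral {0..t} (\<lambda>s. \<bar>f s\<bar>) = integral {0..p} (\<lambda>s. \<bar>f s\<bar>) + integral {p..t} (\<lambda>s. \<bar>f s\<bar>)"
      using Henstock_Kurzweil_Integration.integral_combine[of 0 p t "\<lambda>s. \<bar>f s\<bar>"] p False by simp
    then show ?thesis
      using int[of 0 p] int'[of t] G_pos[of t] p False by simp
  qed
qed

lemma integral_abs_nonneg_function:
  fixes f G :: "real \<Rightarrow> real"
  assumes G: "\<And>s. (G has_real_derivative f s) (at s)"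
    and pos: "\<And>s. 0 \<le> s \<Longrightarrow> f s \<ge> 0"
    and G_neg: "\<And>s. 0 \<le> s \<Longrightarrow> G s \<le> 0"
    and t: "t \<ge> 0"
  shows "integral {0..t} (\<lambda>s. \<bar>f s\<bar>) \<le> - G 0"
proof -
  have "((\<lambda>s. \<bar>f s\<bar>) has_integral G t - G 0) {0..t}"
    using pos t
    by (intro has_integral_eq[OF _ fundamental_theorem_of_calculus[of 0 t G f]])
       (auto intro: has_vector_derivative_at_within[OF G[unfolded has_real_derivative_iff_has_vector_derivative]])
  then show ?thesis using G_neg[OF t] by (simp add: integral_unique)
qed

text \<open>The parameters stand for the two eigenvalues of a \<open>2 \<times> 2\<close> matrix.\<close>

context
  fixes l1 l2 :: real
  assumes l: "0 < l2" "l2 \<le> l1"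
begin

lemma integral_putzer_weight:
  assumes "t \<ge> 0"
  shows "integral {0..t} (\<lambda>s. \<bar>- (putzer_weight l1 l2 s * b)\<bar>) \<le> \<bar>b\<bar> / (l1 * l2)"
proof -
  \<comment> \<open>From the differential equation, \<open>l1 w = exp (- l2 s) - w'\<close>; integrating both terms gives this primitive.\<close>
  let ?W = "\<lambda>s. - ((exp (- l2 * s) + l2 * putzer_weight l1 l2 s) * \<bar>b\<bar> / (l1 * l2))"
  have "integral {0..t} (\<lambda>s. \<bar>putzer_weight l1 l2 s * \<bar>b\<bar>\<bar>) \<le> - ?W 0"
  proof (rule integral_abs_nonneg_function[OF _ _ _ assms])
    show "(?W has_real_derivative putzer_weight l1 l2 s * \<bar>b\<bar>) (at s)" for s
      using l by (auto intro!: derivative_eq_intros simp: divide_simps algebra_simps)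
    fix s :: real assume s: "0 \<le> s"
    note w = putzer_weight_nonneg[OF s, of l1 l2]
    then show "0 \<le> putzer_weight l1 l2 s * \<bar>b\<bar>" by simp
    have "0 \<le> (exp (- l2 * s) + l2 * putzer_weight l1 l2 s) * \<bar>b\<bar> / (l1 * l2)"
      using l w by (intro divide_nonneg_pos mult_nonneg_nonneg add_nonneg_nonneg) auto
    then show "?W s \<le> 0" by simp
  qed
  then show ?thesis by (simp add: abs_mult)
qed

text \<open>The entry of \<open>exp (- s A)\<close> at a diagonal position where \<open>A\<close> itself has the entry \<open>a\<close>.\<close>

definition diag_entry :: "real \<Rightarrow> real \<Rightarrow> real" where
  "diag_entry a s = exp (- l2 * s) - putzer_weight l1 l2 s * (a - l2)"

text \<open>The primitive of \<^term>\<open>diag_entry a\<close> that vanishes at infinity.\<close>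

definition diag_primitive :: "real \<Rightarrow> real \<Rightarrow> real" where
  "diag_primitive a s =
     ((a - l2) * (exp (- l2 * s) + l2 * putzer_weight l1 l2 s) - l1 * exp (- l2 * s)) / (l1 * l2)"

lemma DERIV_diag_primitive: "(diag_primitive a has_real_derivative diag_entry a s) (at s)"
  using l unfolding diag_primitive_def[abs_def] diag_entry_def
  by (auto intro!: derivative_eq_intros simp: field_simps)

text \<open>For \<open>a \<le> l1\<close> the relation \<open>(l1 - l2) w = exp (- l2 s) - exp (- l1 s)\<close> bounds the entry from
  below by \<open>exp (- l1 s)\<close>, so that it never changes sign.\<close>

lemma integral_diag_entry_nonneg:
  assumes a: "a \<le> l1" and t: "t \<ge> 0"
  shows "integral {0..t} (\<lambda>s. \<bar>diag_entry a s\<bar>) \<le> (l1 + l2 - a) / (l1 * l2)"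
proof -
  have "integral {0..t} (\<lambda>s. \<bar>diag_entry a s\<bar>) \<le> - diag_primitive a 0"
  proof (rule integral_abs_nonneg_function[OF DERIV_diag_primitive _ _ t])
    fix s :: real assume s: "0 \<le> s"
    note w = putzer_weight_nonneg[OF s, of l1 l2]
    have "putzer_weight l1 l2 s * (a - l2) \<le> (l1 - l2) * putzer_weight l1 l2 s"
      using mult_right_mono[of "a - l2" "l1 - l2" "putzer_weight l1 l2 s"] a w by (simp add: mult.commute)
    then show "diag_entry a s \<ge> 0"
      using exp_ge_zero[of "- l1 * s"] unfolding diag_entry_def putzer_weight_diff by linarith
    have "(a - l2) * (exp (- l2 * s) + l2 * putzer_weight l1 l2 s) 
        \<le> (l1 - l2) * (exp (- l2 * s) + l2 * putzer_weight l1 l2 s)"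
      using a w l by (intro mult_right_mono) auto
    also have "\<dots> = (l1 - l2) * exp (- l2 * s) + l2 * (exp (- l2 * s) - exp (- l1 * s))"
      unfolding putzer_weight_diff[symmetric] by (simp add: algebra_simps)
    also have "\<dots> \<le> l1 * exp (- l2 * s)"
      using l by (simp add: algebra_simps)
    finally show "diag_primitive a s \<le> 0"
      using l unfolding diag_primitive_def by (intro divide_nonpos_pos) auto
  qed
  then show ?thesis using l by (simp add: diag_primitive_def field_simps)
qed

text \<open>The entry is \<open>exp (- l2 s)\<close> times \<open>1 - (a - l2) w s exp (l2 s)\<close>, and the second factor
  decreases. Hence the zero \<open>p\<close> separates nonnegative from nonpositive values, and at \<open>p\<close> the primitive
  collapses to \<open>(a - l1) exp (- l2 p) / (l1 l2)\<close>.\<close>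

lemma integral_diag_entry_sign_change:
  assumes a: "a > l1" and t: "t \<ge> 0"
    and p: "p \<ge> 0" and zero: "putzer_weight l1 l2 p * (a - l2) = exp (- l2 * p)"
  shows "integral {0..t} (\<lambda>s. \<bar>diag_entry a s\<bar>)
      \<le> (l1 + l2 - a + 2 * (a - l1) * exp (- l2 * p)) / (l1 * l2)"
proof -
  let ?w = "putzer_weight l1 l2"
  have at_p: "?w p * exp (l2 * p) * (a - l2) = 1"
    using zero by (simp add: exp_minus field_simps)
  have factor: "diag_entry a s = exp (- l2 * s) * (1 - ?w s * exp (l2 * s) * (a - l2))" for s
    by (simp add: diag_entry_def exp_minus field_simps)
  have neg: "diag_entry a s \<le> 0" if "p \<le> s" for s
    using mult_right_mono[OF putzer_weight_ratio_mono[OF that, of l1 l2], of "a - l2"] at_p a l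
    unfolding factor by (simp add: mult_le_0_iff)
  have pos: "diag_entry a s \<ge> 0" if "s \<le> p" for s
    using mult_right_mono[OF putzer_weight_ratio_mono[OF that, of l1 l2], of "a - l2"] at_p a l
    unfolding factor by simp
  have "integral {0..t} (\<lambda>s. \<bar>diag_entry a s\<bar>) \<le> 2 * diag_primitive a p - diag_primitive a 0"
  proof (rule integral_abs_one_sign_change[OF DERIV_diag_primitive _ p pos neg _ t])
    show "continuous_on UNIV (diag_entry a)"
      unfolding diag_entry_def[abs_def]
      by (intro continuous_intros DERIV_continuous_on[OF DERIV_putzer_weight])
    fix s assume s: "p \<le> s"
    have "exp (- l2 * s) \<le> ?w s * (a - l2)"
      using neg[OF s] by (simp add: diag_entry_def)
    then have "l2 * exp (- l2 * s) \<le> l2 * (?w s * (a - l2))"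
      using l by simp
    moreover have "(a - l1) * exp (- l2 * s) \<ge> 0" using a by simp
    moreover have "(a - l2) * (exp (- l2 * s) + l2 * ?w s) - l1 * exp (- l2 * s)
        = (l2 * (?w s * (a - l2)) - l2 * exp (- l2 * s)) + (a - l1) * exp (- l2 * s)"
      by (simp add: algebra_simps)
    ultimately have "(a - l2) * (exp (- l2 * s) + l2 * ?w s) - l1 * exp (- l2 * s) \<ge> 0"
      by linarith
    then show "0 \<le> diag_primitive a s"
      unfolding diag_primitive_def using l by simp
  qed
  also have "diag_primitive a p = (a - l1) * exp (- l2 * p) / (l1 * l2)"
  proof -
    have "(a - l2) * (exp (- l2 * p) + l2 * ?w p) - l1 * exp (- l2 * p)
        = (a - l2 - l1) * exp (- l2 * p) + l2 * (?w p * (a - l2))"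
      by (simp add: algebra_simps)
    also have "\<dots> = (a - l1) * exp (- l2 * p)"
      unfolding zero by (simp add: algebra_simps)
    finally show ?thesis by (simp add: diag_primitive_def)
  qed
  also have "diag_primitive a 0 = (a - l1 - l2) / (l1 * l2)"
    by (simp add: diag_primitive_def algebra_simps)
  also have "2 * ((a - l1) * exp (- l2 * p) / L) - (a - l1 - l2) / L
      = (l1 + l2 - a + 2 * (a - l1) * exp (- l2 * p)) / L" for L
    by (simp add: add_divide_distrib diff_divide_distrib)
  finally show ?thesis .
qed

section \<open>Stability for two positive eigenvalues\<close>

text \<open>Under these hypotheses \<open>E s = exp (- l2 s) I - w s (A - l2 I)\<close> is the propagator: its differential
  equation is the Cayley-Hamilton identity \<open>(A - l1 I) (A - l2 I) = 0\<close>. The off-diagonal entries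
  contribute \<open>\<bar>b\<bar> / (l1 l2)\<close> and \<open>\<bar>c\<bar> / (l1 l2)\<close>, so only bounds for the two diagonal
  entries are left as parameters.\<close>

lemma hyers_ulam_of_diag_bounds:
  fixes A :: "real^2^2"
  assumes trace: "A $ 1 $ 1 + A $ 2 $ 2 = l1 + l2"
    and det: "A $ 1 $ 1 * A $ 2 $ 2 - A $ 1 $ 2 * A $ 2 $ 1 = l1 * l2"
    and D1: "\<And>t. t \<ge> 0 \<Longrightarrow> integral {0..t} (\<lambda>s. \<bar>diag_entry (A $ 1 $ 1) s\<bar>) \<le> D1 / (l1 * l2)"
    and D2: "\<And>t. t \<ge> 0 \<Longrightarrow> integral {0..t} (\<lambda>s. \<bar>diag_entry (A $ 2 $ 2) s\<bar>) \<le> D2 / (l1 * l2)"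
    and D: "D1 > 0 \<or> D2 > 0"
  shows "hyers_ulam_stable_with A
    (max ((D1 + \<bar>A $ 1 $ 2\<bar>) / (l1 * l2)) ((D2 + \<bar>A $ 2 $ 1\<bar>) / (l1 * l2)))"
proof -
  let ?w = "putzer_weight l1 l2"
  define E where "E s = exp (- l2 * s) *\<^sub>R mat 1 - ?w s *\<^sub>R (A - l2 *\<^sub>R mat 1)" for s
  have E: "E s $ 1 $ 1 = diag_entry (A $ 1 $ 1) s" "E s $ 1 $ 2 = - (?w s * A $ 1 $ 2)"
     "E s $ 2 $ 1 = - (?w s * A $ 2 $ 1)" "E s $ 2 $ 2 = diag_entry (A $ 2 $ 2) s" for s
    by (auto simp: E_def diag_entry_def mat_def)
  have cayley_hamilton: "A ** (A - l2 *\<^sub>R mat 1) = l1 *\<^sub>R (A - l2 *\<^sub>R mat 1)"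
  proof -
    have d: "A $ 2 $ 2 = l1 + l2 - A $ 1 $ 1" using trace by simp
    have bc: "A $ 1 $ 2 * A $ 2 $ 1 = A $ 1 $ 1 * (l1 + l2 - A $ 1 $ 1) - l1 * l2"
      using det unfolding d by simp
    have cb: "A $ 2 $ 1 * A $ 1 $ 2 = A $ 1 $ 1 * (l1 + l2 - A $ 1 $ 1) - l1 * l2"
      using bc by (simp add: mult.commute)
    show ?thesis
      by (simp add: vec_eq_iff forall_2 matrix_matrix_mult_def sum_2 mat_def d bc cb)
         (simp add: algebra_simps)
  qed
  show ?thesis
  proof (rule hyers_ulam_of_propagator[of E])
    show "E 0 = mat 1" by (simp add: E_def)
    show "A ** E s = E s ** A" for s
      by (simp add: vec_eq_iff forall_2 matrix_matrix_mult_def sum_2 E_def mat_def algebra_simps)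
    show "(E has_vector_derivative - (A ** E s)) (at s)" for s
    proof -
      have "(E has_vector_derivative (- l2 * exp (- l2 * s)) *\<^sub>R mat 1
          - (exp (- l2 * s) - l1 * ?w s) *\<^sub>R (A - l2 *\<^sub>R mat 1)) (at s)"
        unfolding E_def[abs_def]
        by (intro has_vector_derivative_diff has_vector_derivative_real_field)
           (auto intro!: derivative_eq_intros)
      moreover have "(- l2 * exp (- l2 * s)) *\<^sub>R mat 1
          - (exp (- l2 * s) - l1 * ?w s) *\<^sub>R (A - l2 *\<^sub>R mat 1) = - (A ** E s)"
      proof -
        have "A ** E s = exp (- l2 * s) *\<^sub>R A - ?w s *\<^sub>R (A ** (A - l2 *\<^sub>R mat 1))"
          by (simp add: E_def vec_eq_iff forall_2 matrix_matrix_mult_def sum_2 mat_def algebra_simps)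
        then show ?thesis
          unfolding cayley_hamilton by (simp add: algebra_simps)
      qed
      ultimately show ?thesis by simp
    qed
    show "0 < max ((D1 + \<bar>A $ 1 $ 2\<bar>) / (l1 * l2)) ((D2 + \<bar>A $ 2 $ 1\<bar>) / (l1 * l2))"
      using D l by (auto simp: less_max_iff_disj)
    fix i :: 2 and s :: real assume s: "s \<ge> 0"
    show "(\<Sum>j\<in>UNIV. integral {0..s} (\<lambda>r. \<bar>E r $ i $ j\<bar>))
      \<le> max ((D1 + \<bar>A $ 1 $ 2\<bar>) / (l1 * l2)) ((D2 + \<bar>A $ 2 $ 1\<bar>) / (l1 * l2))"
      using exhaust_2[of i] D1[OF s] D2[OF s] integral_putzer_weight[OF s, of "A $ 1 $ 2"]
        integral_putzer_weight[OF s, of "A $ 2 $ 1"]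
      by (auto simp: sum_2 E add_divide_distrib simp del: abs_minus_cancel)
  qed
qed

text \<open>The two diagonal entries of \<open>A\<close> are symmetric about the mean of the eigenvalues. So either both
  lie between the eigenvalues, and no diagonal entry of the propagator changes sign, or one lies above
  \<open>l1\<close> and the other below \<open>l2\<close>, and exactly the former gives a sign change. The three cases follow
  the position of the first diagonal entry.\<close>

lemma
  fixes A :: "real^2^2"
  assumes trace: "A $ 1 $ 1 + A $ 2 $ 2 = l1 + l2"
    and det: "A $ 1 $ 1 * A $ 2 $ 2 - A $ 1 $ 2 * A $ 2 $ 1 = l1 * l2"
  shows hyers_ulam_diag_between:
      "\<lbrakk>l2 \<le> A $ 1 $ 1; A $ 1 $ 1 \<le> l1\<rbrakk> \<Longrightarrow>
        hyers_ulam_stable_with A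
          (max ((l1 + l2 - A $ 1 $ 1 + \<bar>A $ 1 $ 2\<bar>) / (l1 * l2)) ((A $ 1 $ 1 + \<bar>A $ 2 $ 1\<bar>) / (l1 * l2)))"
    and hyers_ulam_diag_above:
      "\<lbrakk>l1 < A $ 1 $ 1; 0 \<le> p; putzer_weight l1 l2 p * (A $ 1 $ 1 - l2) = exp (- l2 * p)\<rbrakk> \<Longrightarrow>
        hyers_ulam_stable_with A
          (max ((l1 + l2 - A $ 1 $ 1 + 2 * (A $ 1 $ 1 - l1) * exp (- l2 * p) + \<bar>A $ 1 $ 2\<bar>) / (l1 * l2))
               ((A $ 1 $ 1 + \<bar>A $ 2 $ 1\<bar>) / (l1 * l2)))"
    and hyers_ulam_diag_below:
      "\<lbrakk>A $ 1 $ 1 < l2; 0 \<le> p; putzer_weight l1 l2 p * (l1 - A $ 1 $ 1) = exp (- l2 * p)\<rbrakk> \<Longrightarrow>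
        hyers_ulam_stable_with A
          (max ((l1 + l2 - A $ 1 $ 1 + \<bar>A $ 1 $ 2\<bar>) / (l1 * l2))
               ((A $ 1 $ 1 + 2 * (l2 - A $ 1 $ 1) * exp (- l2 * p) + \<bar>A $ 2 $ 1\<bar>) / (l1 * l2)))"
proof -
  have d: "A $ 2 $ 2 = l1 + l2 - A $ 1 $ 1" using trace by simp
  {
    assume "l2 \<le> A $ 1 $ 1" "A $ 1 $ 1 \<le> l1"
    with l d show "hyers_ulam_stable_with A
          (max ((l1 + l2 - A $ 1 $ 1 + \<bar>A $ 1 $ 2\<bar>) / (l1 * l2)) ((A $ 1 $ 1 + \<bar>A $ 2 $ 1\<bar>) / (l1 * l2)))"
      using integral_diag_entry_nonneg[of "A $ 1 $ 1"] integral_diag_entry_nonneg[of "A $ 2 $ 2"]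
      by (intro hyers_ulam_of_diag_bounds[OF trace det]) auto
  next
    assume "l1 < A $ 1 $ 1" "0 \<le> p" "putzer_weight l1 l2 p * (A $ 1 $ 1 - l2) = exp (- l2 * p)"
    with l d show "hyers_ulam_stable_with A
          (max ((l1 + l2 - A $ 1 $ 1 + 2 * (A $ 1 $ 1 - l1) * exp (- l2 * p) + \<bar>A $ 1 $ 2\<bar>) / (l1 * l2))
               ((A $ 1 $ 1 + \<bar>A $ 2 $ 1\<bar>) / (l1 * l2)))"
      using integral_diag_entry_sign_change[of "A $ 1 $ 1" _ p] integral_diag_entry_nonneg[of "A $ 2 $ 2"]
      by (intro hyers_ulam_of_diag_bounds[OF trace det]) auto
  next
    assume "A $ 1 $ 1 < l2" "0 \<le> p" "putzer_weight l1 l2 p * (l1 - A $ 1 $ 1) = exp (- l2 * p)"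
    with l d show "hyers_ulam_stable_with A
          (max ((l1 + l2 - A $ 1 $ 1 + \<bar>A $ 1 $ 2\<bar>) / (l1 * l2))
               ((A $ 1 $ 1 + 2 * (l2 - A $ 1 $ 1) * exp (- l2 * p) + \<bar>A $ 2 $ 1\<bar>) / (l1 * l2)))"
      using integral_diag_entry_sign_change[of "A $ 2 $ 2" _ p] integral_diag_entry_nonneg[of "A $ 1 $ 1"]
      by (intro hyers_ulam_of_diag_bounds[OF trace det]) auto
  }
qed

end

section \<open>Explicit constants\<close>

text \<open>The zero of a diagonal entry solves \<open>exp ((l1 - l2) p) = (x - l2) / (x - l1)\<close>, whence the real
  power in the stability constant.\<close>

lemma putzer_weight_crossing_distinct:
  assumes "l2 < l1" "l1 < x"
  obtains p where "0 \<le> p" "putzer_weight l1 l2 p * (x - l2) = exp (- l2 * p)"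
    "exp (- l2 * p) = ((x - l2) / (x - l1)) powr (- l2 / (l1 - l2))"
proof
  define p where "p = ln ((x - l2) / (x - l1)) / (l1 - l2)"
  have R: "(x - l2) / (x - l1) > 1" using assms by (simp add: field_simps)
  then show "0 \<le> p" using assms by (simp add: p_def)
  have "(l1 - l2) * p = ln ((x - l2) / (x - l1))" using assms by (simp add: p_def)
  then have "exp ((l1 - l2) * p) = (x - l2) / (x - l1)"
    using R by simp
  then have "exp (- l1 * p) = exp (- l2 * p) * ((x - l1) / (x - l2))"
    using assms by (simp add: algebra_simps exp_minus exp_diff divide_simps split: if_splits)
  then show "putzer_weight l1 l2 p * (x - l2) = exp (- l2 * p)"
    using assms by (simp add: putzer_weight_def divide_simps) (simp add: algebra_simps)
  show "exp (- l2 * p) = ((x - l2) / (x - l1)) powr (- l2 / (l1 - l2))"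
    using R assms by (simp add: powr_def p_def)
qed

lemma putzer_weight_crossing_repeated:
  assumes "l < x"
  shows "putzer_weight l l (1 / (x - l)) * (x - l) = exp (- l * (1 / (x - l)))"
  using assms by (simp add: putzer_weight_def)

section \<open>Inverse and eigenvalues of a two by two matrix\<close>

lemma matrix_inv_eqI:
  fixes A :: "real^'n^'m"
  assumes AB: "A ** B = mat 1" and BA: "B ** A = mat 1"
  shows "matrix_inv A = B"
proof -
  have "\<exists>B. A ** B = mat 1 \<and> B ** A = mat 1" using assms by blast
  from someI_ex[OF this] have "matrix_inv A ** A = mat 1"
    unfolding matrix_inv_def by blast
  then have "matrix_inv A ** A ** B = B" by simp
  then show ?thesis by (simp add: AB flip: matrix_mul_assoc)
qed

lemma mat_infnorm_matrix_inv_2: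
  fixes A :: "real^2^2"
  assumes "A $ 1 $ 1 * A $ 2 $ 2 - A $ 1 $ 2 * A $ 2 $ 1 = D" "D > 0"
  shows "mat_infnorm (matrix_inv A) =
    max ((\<bar>A $ 2 $ 2\<bar> + \<bar>A $ 1 $ 2\<bar>) / D) ((\<bar>A $ 1 $ 1\<bar> + \<bar>A $ 2 $ 1\<bar>) / D)"
proof -
  let ?B = "(1 / D) *\<^sub>R vector [vector [A $ 2 $ 2, - A $ 1 $ 2], vector [- A $ 2 $ 1, A $ 1 $ 1]] :: real^2^2"
  have AB: "A ** ?B = mat 1" "?B ** A = mat 1"
    using assms by (auto simp: vec_eq_iff forall_2 matrix_matrix_mult_def sum_2 mat_def divide_simps algebra_simps)
  then have "matrix_inv A = ?B" by (rule matrix_inv_eqI)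
  then show ?thesis
    using assms by (simp add: mat_infnorm_2 abs_mult add_divide_distrib add.commute)
qed

lemma is_eigenvalue_2_root:
  fixes A :: "real^2^2"
  assumes "is_eigenvalue A l"
  shows "(A $ 1 $ 1 - l) * (A $ 2 $ 2 - l) = A $ 1 $ 2 * A $ 2 $ 1"
proof -
  from assms obtain v where v: "v \<noteq> 0" "A *v v = l *\<^sub>R v" by (auto simp: is_eigenvalue_def)
  let ?x = "v $ 1" and ?y = "v $ 2"
  let ?k = "(A $ 1 $ 1 - l) * (A $ 2 $ 2 - l) - A $ 1 $ 2 * A $ 2 $ 1"
  have 1: "(A $ 1 $ 1 - l) * ?x + A $ 1 $ 2 * ?y = 0" and 2: "A $ 2 $ 1 * ?x + (A $ 2 $ 2 - l) * ?y = 0"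
    using v(2) by (simp_all add: vec_eq_iff forall_2 matrix_vector_mult_def sum_2 algebra_simps)
  have "?k * ?x = 0"
  proof -
    have "?k * ?x = (A $ 2 $ 2 - l) * ((A $ 1 $ 1 - l) * ?x + A $ 1 $ 2 * ?y)
        - A $ 1 $ 2 * (A $ 2 $ 1 * ?x + (A $ 2 $ 2 - l) * ?y)" by (simp add: algebra_simps)
    then show ?thesis unfolding 1 2 by simp
  qed
  moreover have "?k * ?y = 0"
  proof -
    have "?k * ?y = (A $ 1 $ 1 - l) * (A $ 2 $ 1 * ?x + (A $ 2 $ 2 - l) * ?y)
        - A $ 2 $ 1 * ((A $ 1 $ 1 - l) * ?x + A $ 1 $ 2 * ?y)" by (simp add: algebra_simps)
    then show ?thesis unfolding 1 2 by simp
  qed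
  moreover have "?x \<noteq> 0 \<or> ?y \<noteq> 0" using v(1) by (auto simp: vec_eq_iff forall_2)
  ultimately show ?thesis by auto
qed

lemma distinct_eigenvalues_2:
  fixes A :: "real^2^2"
  assumes "is_eigenvalue A l1" "is_eigenvalue A l2" "l1 \<noteq> l2"
  shows "A $ 1 $ 1 + A $ 2 $ 2 = l1 + l2"
    and "A $ 1 $ 1 * A $ 2 $ 2 - A $ 1 $ 2 * A $ 2 $ 1 = l1 * l2"
proof -
  note r = is_eigenvalue_2_root[OF assms(1)] is_eigenvalue_2_root[OF assms(2)]
  have "(l1 - l2) * (A $ 1 $ 1 + A $ 2 $ 2 - (l1 + l2)) = 0"
    using r by (simp add: algebra_simps)
  then show tr: "A $ 1 $ 1 + A $ 2 $ 2 = l1 + l2" using assms(3) by simp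
  have d: "A $ 2 $ 2 = l1 + l2 - A $ 1 $ 1" using tr by simp
  show "A $ 1 $ 1 * A $ 2 $ 2 - A $ 1 $ 2 * A $ 2 $ 1 = l1 * l2"
    using r(1) unfolding d by (simp add: algebra_simps)
qed

text \<open>At a double root both the characteristic polynomial and its derivative vanish; the derivative
  yields the trace, and then the polynomial yields the determinant.\<close>

lemma repeated_eigenvalue_2:
  fixes A :: "real^2^2"
  assumes "is_repeated_eigenvalue A l"
  shows "A $ 1 $ 1 + A $ 2 $ 2 = l + l"
    and "A $ 1 $ 1 * A $ 2 $ 2 - A $ 1 $ 2 * A $ 2 $ 1 = l * l"
proof -
  from assms have "[:- l, 1:] ^ 2 dvd charpoly A"
    by (simp add: is_repeated_eigenvalue_def order_divides)
  then obtain q where q: "charpoly A = [:- l, 1:] ^ 2 * q" by (auto elim: dvdE)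
  have "poly (pderiv (charpoly A)) l = 0"
    unfolding q power2_eq_square pderiv_mult poly_add poly_mult by simp
  then show tr: "A $ 1 $ 1 + A $ 2 $ 2 = l + l"
    by (simp add: charpoly_2 pderiv_pCons)
  have d: "A $ 2 $ 2 = l + l - A $ 1 $ 1" using tr by simp
  have "poly (charpoly A) l = 0" unfolding q by simp
  then show "A $ 1 $ 1 * A $ 2 $ 2 - A $ 1 $ 2 * A $ 2 $ 1 = l * l"
    unfolding charpoly_2 det_2 d by (simp add: algebra_simps)
qed

section \<open>Stability constants in closed form\<close>

lemma
  fixes A :: "real^2^2"
  assumes l: "0 < l2" "l2 < l1"
    and trace: "A $ 1 $ 1 + A $ 2 $ 2 = l1 + l2"
    and det: "A $ 1 $ 1 * A $ 2 $ 2 - A $ 1 $ 2 * A $ 2 $ 1 = l1 * l2"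
    and a: "a = A $ 1 $ 1"
  shows hyers_ulam_distinct_above: "l1 < a \<Longrightarrow> hyers_ulam_stable_with A
      (max ((l1 + l2 + \<bar>A $ 1 $ 2\<bar> - a + 2 * (a - l1) * ((a - l2) / (a - l1)) powr (- l2 / (l1 - l2))) / (l1 * l2))
           ((a + \<bar>A $ 2 $ 1\<bar>) / (l1 * l2)))"
    and hyers_ulam_distinct_below: "a < l2 \<Longrightarrow> hyers_ulam_stable_with A
      (max ((l1 + l2 + \<bar>A $ 1 $ 2\<bar> - a) / (l1 * l2))
           ((a + \<bar>A $ 2 $ 1\<bar> + 2 * (l2 - a) * ((l1 - a) / (l2 - a)) powr (- l2 / (l1 - l2))) / (l1 * l2)))"
proof -
  {
    assume "l1 < a"
    then obtain p where p: "0 \<le> p" "putzer_weight l1 l2 p * (a - l2) = exp (- l2 * p)"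
      "exp (- l2 * p) = ((a - l2) / (a - l1)) powr (- l2 / (l1 - l2))"
      using putzer_weight_crossing_distinct[of l2 l1 a] l by blast
    with hyers_ulam_diag_above[OF l(1) less_imp_le[OF l(2)] trace det, of p] \<open>l1 < a\<close>
    show "hyers_ulam_stable_with A
      (max ((l1 + l2 + \<bar>A $ 1 $ 2\<bar> - a + 2 * (a - l1) * ((a - l2) / (a - l1)) powr (- l2 / (l1 - l2))) / (l1 * l2))
           ((a + \<bar>A $ 2 $ 1\<bar>) / (l1 * l2)))"
      by (simp only: a) (simp add: algebra_simps)
  next
    assume "a < l2"
    then obtain p where p: "0 \<le> p" "putzer_weight l1 l2 p * (l1 - a) = exp (- l2 * p)"
      "exp (- l2 * p) = ((l1 - a) / (l2 - a)) powr (- l2 / (l1 - l2))"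
      \<comment> \<open>The second diagonal entry is \<open>l1 + l2 - a\<close>, and it exceeds \<open>l1\<close>.\<close>
      using putzer_weight_crossing_distinct[of l2 l1 "l1 + l2 - a"] l by auto
    with hyers_ulam_diag_below[OF l(1) less_imp_le[OF l(2)] trace det, of p] \<open>a < l2\<close>
    show "hyers_ulam_stable_with A
      (max ((l1 + l2 + \<bar>A $ 1 $ 2\<bar> - a) / (l1 * l2))
           ((a + \<bar>A $ 2 $ 1\<bar> + 2 * (l2 - a) * ((l1 - a) / (l2 - a)) powr (- l2 / (l1 - l2))) / (l1 * l2)))"
      by (simp only: a) (simp add: algebra_simps)
  }
qed

lemma
  fixes A :: "real^2^2"
  assumes l: "0 < l"
    and trace: "A $ 1 $ 1 + A $ 2 $ 2 = l + l"
    and det: "A $ 1 $ 1 * A $ 2 $ 2 - A $ 1 $ 2 * A $ 2 $ 1 = l * l"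
    and \<eta>: "\<eta> = l - A $ 1 $ 1"
  shows hyers_ulam_repeated_above: "\<eta> < 0 \<Longrightarrow> hyers_ulam_stable_with A
      (max ((l + \<bar>\<eta>\<bar> + \<bar>A $ 2 $ 1\<bar>) / l\<^sup>2)
           ((l + \<bar>A $ 1 $ 2\<bar> + \<bar>\<eta>\<bar> * (- 1 + 2 * exp (- (l / \<bar>\<eta>\<bar>)))) / l\<^sup>2))"
    and hyers_ulam_repeated_below: "0 < \<eta> \<Longrightarrow> hyers_ulam_stable_with A
      (max ((l + \<eta> + \<bar>A $ 1 $ 2\<bar>) / l\<^sup>2)
           ((l + \<bar>A $ 2 $ 1\<bar> + \<eta> * (- 1 + 2 * exp (- (l / \<eta>)))) / l\<^sup>2))"
proof -
  have a: "A $ 1 $ 1 = l - \<eta>" using \<eta> by simp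
  {
    assume "\<eta> < 0"
    then show "hyers_ulam_stable_with A
      (max ((l + \<bar>\<eta>\<bar> + \<bar>A $ 2 $ 1\<bar>) / l\<^sup>2)
           ((l + \<bar>A $ 1 $ 2\<bar> + \<bar>\<eta>\<bar> * (- 1 + 2 * exp (- (l / \<bar>\<eta>\<bar>)))) / l\<^sup>2))"
      using hyers_ulam_diag_above[OF l order_refl trace det, of "1 / - \<eta>"]
        putzer_weight_crossing_repeated[of l "l - \<eta>"]
      unfolding a by (simp add: max.commute power2_eq_square algebra_simps)
  next
    assume "0 < \<eta>"
    then show "hyers_ulam_stable_with A
      (max ((l + \<eta> + \<bar>A $ 1 $ 2\<bar>) / l\<^sup>2)
           ((l + \<bar>A $ 2 $ 1\<bar> + \<eta> * (- 1 + 2 * exp (- (l / \<eta>)))) / l\<^sup>2))"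
      using hyers_ulam_diag_below[OF l order_refl trace det, of "1 / \<eta>"]
        putzer_weight_crossing_repeated[of l "l + \<eta>"]
      unfolding a by (simp add: power2_eq_square algebra_simps)
  }
qed

lemma hyers_ulam_matrix_inv:
  fixes A :: "real^2^2"
  assumes l: "0 < l2" "l2 \<le> l1"
    and trace: "A $ 1 $ 1 + A $ 2 $ 2 = l1 + l2"
    and det: "A $ 1 $ 1 * A $ 2 $ 2 - A $ 1 $ 2 * A $ 2 $ 1 = l1 * l2"
    and a: "l2 \<le> A $ 1 $ 1" "A $ 1 $ 1 \<le> l1"
  shows "hyers_ulam_stable_with A (mat_infnorm (matrix_inv A))"
proof -
  have "A $ 2 $ 2 = l1 + l2 - A $ 1 $ 1" using trace by simp
  then show ?thesis
    using mat_infnorm_matrix_inv_2[OF det] hyers_ulam_diag_between[OF l trace det a] l a by simp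
qed

lemma hyers_ulam_matrix_inv_neg:
  fixes A :: "real^2^2"
  assumes l: "l1 < 0" "l2 \<le> l1"
    and trace: "A $ 1 $ 1 + A $ 2 $ 2 = l1 + l2"
    and det: "A $ 1 $ 1 * A $ 2 $ 2 - A $ 1 $ 2 * A $ 2 $ 1 = l1 * l2"
    and a: "l2 \<le> A $ 1 $ 1" "A $ 1 $ 1 \<le> l1"
  shows "hyers_ulam_stable_with A (mat_infnorm (matrix_inv A))"
proof (rule hyers_ulam_time_reversal)
  have "0 < l1 * l2" using l by (simp add: mult_neg_neg)
  then have "mat_infnorm (matrix_inv (- A)) = mat_infnorm (matrix_inv A)"
    using mat_infnorm_matrix_inv_2[of A "l1 * l2"] mat_infnorm_matrix_inv_2[of "- A" "l1 * l2"] det by simp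
  then show "hyers_ulam_stable_with (- A) (mat_infnorm (matrix_inv A))"
    using hyers_ulam_matrix_inv[of "- l1" "- l2" "- A"] l trace det a by (simp add: mult.commute)
qed

text \<open>Time reversal replaces the smaller eigenvalue by \<open>- l1\<close>, so the exponents that it produces have
  \<open>l1\<close> in the numerator. Because \<open>l1 / (l1 - l2) = 1 + l2 / (l1 - l2)\<close>, one factor of the base
  can be moved out of the power.\<close>

lemma mult_powr_ratio_shift:
  fixes x y l1 l2 :: real
  assumes "x > 0" "y > 0" "l1 \<noteq> l2"
  shows "x * (y / x) powr (l1 / (l1 - l2)) = y * (y / x) powr (l2 / (l1 - l2))"
proof -
  have "l1 / (l1 - l2) = 1 + l2 / (l1 - l2)"
    using assms(3) by (simp add: field_simps)
  then show ?thesis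
    using assms by (simp add: powr_add)
qed

theorem theorem3p1:
  fixes A :: "real^2^2" and a b c d :: real
  assumes A: "A = vector [vector [a, b], vector [c, d]]"
  shows
    "(\<forall>l1 l2. is_eigenvalue A l1 \<and> is_eigenvalue A l2 \<and> l1 > l2 \<and> l2 > 0 \<longrightarrow>
        (l1 \<ge> a \<and> a \<ge> l2 \<longrightarrow> hyers_ulam_stable_with A (mat_infnorm (matrix_inv A))) \<and>
        (l2 > a \<longrightarrow> hyers_ulam_stable_with A
          (max ((l1 + l2 + \<bar>b\<bar> - a) / (l1 * l2))
               ((a + \<bar>c\<bar> + 2 * (l2 - a) * ((l1 - a) / (l2 - a)) powr (- l2 / (l1 - l2))) / (l1 * l2)))) \<and>
        (a > l1 \<longrightarrow> hyers_ulam_stable_with A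
          (max ((l1 + l2 + \<bar>b\<bar> - a + 2 * (a - l1) * ((a - l2) / (a - l1)) powr (- l2 / (l1 - l2))) / (l1 * l2))
               ((a + \<bar>c\<bar>) / (l1 * l2)))))
   \<and> (\<forall>l1 l2. is_eigenvalue A l1 \<and> is_eigenvalue A l2 \<and> 0 > l1 \<and> l1 > l2 \<longrightarrow>
        (l1 \<ge> a \<and> a \<ge> l2 \<longrightarrow> hyers_ulam_stable_with A (mat_infnorm (matrix_inv A))) \<and>
        (l2 > a \<longrightarrow> hyers_ulam_stable_with A
          (max ((\<bar>l1\<bar> + \<bar>l2\<bar> + a + \<bar>b\<bar> + 2 * (l1 - a) * ((l1 - a) / (l2 - a)) powr (l2 / (l1 - l2))) / (l1 * l2))
               ((\<bar>a\<bar> + \<bar>c\<bar>) / (l1 * l2)))) \<and>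
        (a > l1 \<longrightarrow> hyers_ulam_stable_with A
          (max ((\<bar>l1\<bar> + \<bar>l2\<bar> + a + \<bar>b\<bar>) / (l1 * l2))
               ((- a + \<bar>c\<bar> + 2 * (a - l2) * ((a - l1) / (a - l2)) powr (- l2 / (l1 - l2))) / (l1 * l2)))))
   \<and> (\<forall>l \<eta>. is_repeated_eigenvalue A l \<and> l \<noteq> 0 \<and> \<eta> = l - a \<longrightarrow>
        A = vector [vector [l - \<eta>, b], vector [c, l + \<eta>]] \<and>
        b * c + \<eta>\<^sup>2 = 0 \<and>
        (l > 0 \<longrightarrow>
          (\<eta> = 0 \<longrightarrow> hyers_ulam_stable_with A (mat_infnorm (matrix_inv A))) \<and>
          (\<eta> > 0 \<longrightarrow> hyers_ulam_stable_with A
            (max ((l + \<eta> + \<bar>b\<bar>) / l\<^sup>2)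
                 ((l + \<bar>c\<bar> + \<eta> * (- 1 + 2 * exp (- (l / \<eta>)))) / l\<^sup>2))) \<and>
          (\<eta> < 0 \<longrightarrow> hyers_ulam_stable_with A
            (max ((l + \<bar>\<eta>\<bar> + \<bar>c\<bar>) / l\<^sup>2)
                 ((l + \<bar>b\<bar> + \<bar>\<eta>\<bar> * (- 1 + 2 * exp (- (l / \<bar>\<eta>\<bar>)))) / l\<^sup>2)))) \<and>
        (l < 0 \<longrightarrow>
          (\<eta> = 0 \<longrightarrow> hyers_ulam_stable_with A (mat_infnorm (matrix_inv A))) \<and>
          (\<eta> > 0 \<longrightarrow> hyers_ulam_stable_with A
            (max ((\<bar>l\<bar> + \<eta> + \<bar>c\<bar>) / l\<^sup>2)
                 ((\<bar>l\<bar> + \<bar>b\<bar> + \<eta> * (- 1 + 2 * exp (l / \<eta>))) / l\<^sup>2))) \<and>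
          (\<eta> < 0 \<longrightarrow> hyers_ulam_stable_with A
            (max ((\<bar>l\<bar> + \<bar>\<eta>\<bar> + \<bar>b\<bar>) / l\<^sup>2)
                 ((\<bar>l\<bar> + \<bar>c\<bar> + \<bar>\<eta>\<bar> * (- 1 + 2 * exp (- (l / \<eta>)))) / l\<^sup>2)))))"
proof -
  have e: "A $ 1 $ 1 = a" "A $ 1 $ 2 = b" "A $ 2 $ 1 = c" "A $ 2 $ 2 = d"
    by (simp_all add: A)
  show ?thesis
  proof (intro conjI allI impI; elim conjE)
    fix l1 l2 assume ev: "is_eigenvalue A l1" "is_eigenvalue A l2" and l: "l1 > l2" "l2 > 0"
    note td = distinct_eigenvalues_2[OF ev less_imp_neq[OF l(1), symmetric]]
    show "hyers_ulam_stable_with A (mat_infnorm (matrix_inv A))" if "l1 \<ge> a" "a \<ge> l2"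
      using hyers_ulam_matrix_inv[OF l(2) less_imp_le[OF l(1)] td] that e by simp
    show "hyers_ulam_stable_with A
          (max ((l1 + l2 + \<bar>b\<bar> - a) / (l1 * l2))
               ((a + \<bar>c\<bar> + 2 * (l2 - a) * ((l1 - a) / (l2 - a)) powr (- l2 / (l1 - l2))) / (l1 * l2)))"
      if "l2 > a"
      using hyers_ulam_distinct_below[OF l(2,1) td refl] that unfolding e by simp
    show "hyers_ulam_stable_with A
          (max ((l1 + l2 + \<bar>b\<bar> - a + 2 * (a - l1) * ((a - l2) / (a - l1)) powr (- l2 / (l1 - l2))) / (l1 * l2))
               ((a + \<bar>c\<bar>) / (l1 * l2)))"
      if "a > l1"
      using hyers_ulam_distinct_above[OF l(2,1) td refl] that unfolding e by simp
  next
    fix l1 l2 assume ev: "is_eigenvalue A l1" "is_eigenvalue A l2" and l: "0 > l1" "l1 > l2"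
    note td = distinct_eigenvalues_2[OF ev less_imp_neq[OF l(2), symmetric]]
    have td': "(- A) $ 1 $ 1 + (- A) $ 2 $ 2 = - l2 + - l1"
      "(- A) $ 1 $ 1 * (- A) $ 2 $ 2 - (- A) $ 1 $ 2 * (- A) $ 2 $ 1 = - l2 * - l1"
      using td by (simp_all add: mult.commute)
    have l': "0 < - l1" "- l1 < - l2" using l by auto
    show "hyers_ulam_stable_with A (mat_infnorm (matrix_inv A))" if "l1 \<ge> a" "a \<ge> l2"
      using hyers_ulam_matrix_inv_neg[OF l(1) less_imp_le[OF l(2)] td] that e by simp
    show "hyers_ulam_stable_with A
          (max ((\<bar>l1\<bar> + \<bar>l2\<bar> + a + \<bar>b\<bar> + 2 * (l1 - a) * ((l1 - a) / (l2 - a)) powr (l2 / (l1 - l2))) / (l1 * l2))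
               ((\<bar>a\<bar> + \<bar>c\<bar>) / (l1 * l2)))"
      if "l2 > a"
    proof -
      have "(l1 - a) * ((l1 - a) / (l2 - a)) powr (l2 / (l1 - l2))
          = (l2 - a) * ((l1 - a) / (l2 - a)) powr (l1 / (l1 - l2))"
        using that l by (intro mult_powr_ratio_shift[symmetric]) auto
      then have shift: "2 * (l1 - a) * ((l1 - a) / (l2 - a)) powr (l2 / (l1 - l2))
          = 2 * (l2 - a) * ((l1 - a) / (l2 - a)) powr (l1 / (l1 - l2))"
        by (simp only: mult.assoc)
      show ?thesis
        unfolding shift using hyers_ulam_time_reversal[OF hyers_ulam_distinct_above[OF l' td' refl]] that l
        by (simp add: e algebra_simps)
    qed
    show "hyers_ulam_stable_with A
          (max ((\<bar>l1\<bar> + \<bar>l2\<bar> + a + \<bar>b\<bar>) / (l1 * l2))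
               ((- a + \<bar>c\<bar> + 2 * (a - l2) * ((a - l1) / (a - l2)) powr (- l2 / (l1 - l2))) / (l1 * l2)))"
      if "a > l1"
    proof -
      have "((a - l1) / (a - l2)) powr (- l2 / (l1 - l2)) = ((a - l2) / (a - l1)) powr (l2 / (l1 - l2))"
        using that l by (simp add: powr_minus powr_divide field_simps)
      also have "(a - l2) * \<dots> = (a - l1) * ((a - l2) / (a - l1)) powr (l1 / (l1 - l2))"
        using that l by (intro mult_powr_ratio_shift[symmetric]) auto
      finally have shift: "2 * (a - l2) * ((a - l1) / (a - l2)) powr (- l2 / (l1 - l2))
          = 2 * (a - l1) * ((a - l2) / (a - l1)) powr (l1 / (l1 - l2))"
        by (simp only: mult.assoc)
      show ?thesis
        unfolding shift using hyers_ulam_time_reversal[OF hyers_ulam_distinct_below[OF l' td' refl]] that l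
        by (simp add: e algebra_simps)
    qed
  next
    fix l \<eta> assume rep: "is_repeated_eigenvalue A l" and l: "l \<noteq> 0" and \<eta>: "\<eta> = l - a"
    note td = repeated_eigenvalue_2[OF rep]
    have \<eta>': "\<eta> = l - A $ 1 $ 1" "- \<eta> = - l - (- A) $ 1 $ 1" using \<eta> e by auto
    have td': "(- A) $ 1 $ 1 + (- A) $ 2 $ 2 = - l + - l"
      "(- A) $ 1 $ 1 * (- A) $ 2 $ 2 - (- A) $ 1 $ 2 * (- A) $ 2 $ 1 = - l * - l"
      using td by simp_all
    have d: "d = l + \<eta>" using td(1) unfolding e \<eta> by simp
    show "A = vector [vector [l - \<eta>, b], vector [c, l + \<eta>]]"
      using A d \<eta> by simp
    show "b * c + \<eta>\<^sup>2 = 0"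
      using td(2) unfolding e d \<eta> by (simp add: power2_eq_square algebra_simps)
    show "hyers_ulam_stable_with A (mat_infnorm (matrix_inv A))" if "l > 0" "\<eta> = 0"
      using hyers_ulam_matrix_inv[OF that(1) order_refl td] that(2) \<eta> e by simp
    show "hyers_ulam_stable_with A (mat_infnorm (matrix_inv A))" if "l < 0" "\<eta> = 0"
      using hyers_ulam_matrix_inv_neg[OF that(1) order_refl td] that(2) \<eta> e by simp
    show "hyers_ulam_stable_with A
            (max ((l + \<eta> + \<bar>b\<bar>) / l\<^sup>2)
                 ((l + \<bar>c\<bar> + \<eta> * (- 1 + 2 * exp (- (l / \<eta>)))) / l\<^sup>2))" if "l > 0" "\<eta> > 0"
      using hyers_ulam_repeated_below[OF that(1) td \<eta>'(1) that(2)] unfolding e .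
    show "hyers_ulam_stable_with A
            (max ((l + \<bar>\<eta>\<bar> + \<bar>c\<bar>) / l\<^sup>2)
                 ((l + \<bar>b\<bar> + \<bar>\<eta>\<bar> * (- 1 + 2 * exp (- (l / \<bar>\<eta>\<bar>)))) / l\<^sup>2))" if "l > 0" "\<eta> < 0"
      using hyers_ulam_repeated_above[OF that(1) td \<eta>'(1) that(2)] unfolding e .
    show "hyers_ulam_stable_with A
            (max ((\<bar>l\<bar> + \<eta> + \<bar>c\<bar>) / l\<^sup>2)
                 ((\<bar>l\<bar> + \<bar>b\<bar> + \<eta> * (- 1 + 2 * exp (l / \<eta>))) / l\<^sup>2))" if "l < 0" "\<eta> > 0"
      using hyers_ulam_time_reversal[OF hyers_ulam_repeated_above[OF _ td' \<eta>'(2)]] that by (simp add: e)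
    show "hyers_ulam_stable_with A
            (max ((\<bar>l\<bar> + \<bar>\<eta>\<bar> + \<bar>b\<bar>) / l\<^sup>2)
                 ((\<bar>l\<bar> + \<bar>c\<bar> + \<bar>\<eta>\<bar> * (- 1 + 2 * exp (- (l / \<eta>)))) / l\<^sup>2))" if "l < 0" "\<eta> < 0"
      using hyers_ulam_time_reversal[OF hyers_ulam_repeated_below[OF _ td' \<eta>'(2)]] that by (simp add: e)
  qed
qed

end
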